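(* Let $M^\star\in\mathbb{R}^{n\times n}$ be a rank-$r$ skew-symmetric matrix (so $r$ is even). For $\theta=\mathrm{vec}(\Theta_A,\Theta_B)\in\mathbb{R}^{nr}$ with $\Theta_A,\Theta_B\in\mathbb{R}^{n\times\frac r2}$, set $X(\theta)=[\Theta_A,-\Theta_B]\in\mathbb{R}^{n\times r}$ and $Y(\theta)=[\Theta_B,\Theta_A]\in\mathbb{R}^{n\times r}$. Then $M^\star$ and $(X(\cdot),Y(\cdot))$ satisfy the Correlated Parametric Factorization condition.
   Context: $\mathrm{vec}(A,B)$ is the vector listing all entries of $A$ and $B$ in some fixed order; here $d=nr$. $A\succeq0$ means $A$ is symmetric positive semidefinite. Correlated Parametric Factorization condition for a rank-$r$ matrix $M^\star\in\mathbb{R}^{n_1\times n_2}$ and linear maps $X:\mathbb{R}^d\to\mathbb{R}^{n_1\times r}$, $Y:\mathbb{R}^d\to\mathbb{R}^{n_2\times r}$: for every $\theta\in\mathbb{R}^d$ there exists $\xi\in\mathbb{R}^d$ (not necessarily unique) with $M^\star=X(\xi)Y(\xi)^\top$, $X(\xi)^\top X(\xi)=Y(\xi)^\top Y(\xi)$, and $X(\theta)^\top X(\xi)+Y(\theta)^\top Y(\xi)\succeq 0$. *)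

theory Defs
  imports "Jordan_Normal_Form.DL_Rank"
begin

text \<open>
  Matrices and vectors are those of Jordan_Normal_Form, whose dimensions are natural numbers
  (possibly zero), so that the rank, and with it the dimensions $r$ and $d = nr$, may be
  arbitrary.
\<close>

definition pos_semidef :: "real mat \<Rightarrow> bool" where
  "pos_semidef A \<longleftrightarrow> square_mat A \<and> A\<^sup>T = A \<and>
     (\<forall>v \<in> carrier_vec (dim_row A). 0 \<le> v \<bullet> (A *\<^sub>v v))"

definition append_cols :: "'a :: zero mat \<Rightarrow> 'a mat \<Rightarrow> 'a mat" (infixr \<open>@\<^sub>c\<close> 65) where
  "A @\<^sub>c B = four_block_mat A B (0\<^sub>m 0 (dim_col A)) (0\<^sub>m 0 (dim_col B))"

text \<open>The standing requirements of the condition (the rank of \<open>M\<close>, linearity of \<open>X\<close> and \<open>Y\<close>)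
  are part of the definition.\<close>

definition correlated_parametric_factorization ::
  "nat \<Rightarrow> nat \<Rightarrow> nat \<Rightarrow> nat \<Rightarrow> real mat \<Rightarrow> (real vec \<Rightarrow> real mat) \<Rightarrow> (real vec \<Rightarrow> real mat) \<Rightarrow> bool"
  where
  "correlated_parametric_factorization n1 n2 r d M X Y \<longleftrightarrow>
     M \<in> carrier_mat n1 n2 \<and> vec_space.rank n1 M = r \<and>
     linear_map class_ring (module_vec TYPE(real) d) (module_mat TYPE(real) n1 r) X \<and>
     linear_map class_ring (module_vec TYPE(real) d) (module_mat TYPE(real) n2 r) Y \<and>
     (\<forall>\<theta> \<in> carrier_vec d. \<exists>\<xi> \<in> carrier_vec d.
        M = X \<xi> * (Y \<xi>)\<^sup>T \<and>
        (X \<xi>)\<^sup>T * X \<xi> = (Y \<xi>)\<^sup>T * Y \<xi> \<and>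
        pos_semidef ((X \<theta>)\<^sup>T * X \<xi> + (Y \<theta>)\<^sup>T * Y \<xi>))"

text \<open>
  The entries of a pair \<open>(A, B)\<close> of \<open>n \<times> h\<close> matrices are addressed by \<open>Inl (i, j)\<close> for \<open>A\<close> and
  \<open>Inr (i, j)\<close> for \<open>B\<close>. A fixed order of these entries is a bijection \<open>e\<close> from the addresses to
  the coordinates of a vector of length \<open>2nh\<close>.
\<close>

definition pair_index :: "nat \<Rightarrow> nat \<Rightarrow> (nat \<times> nat + nat \<times> nat) set" where
  "pair_index n h = ({..<n} \<times> {..<h}) <+> ({..<n} \<times> {..<h})"

definition entry_order :: "nat \<Rightarrow> nat \<Rightarrow> (nat \<times> nat + nat \<times> nat \<Rightarrow> nat) \<Rightarrow> bool" where
  "entry_order n h e \<longleftrightarrow> bij_betw e (pair_index n h) {..<n * (2 * h)}"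

definition vec_pair ::
  "nat \<Rightarrow> nat \<Rightarrow> (nat \<times> nat + nat \<times> nat \<Rightarrow> nat) \<Rightarrow> real mat \<Rightarrow> real mat \<Rightarrow> real vec" where
  "vec_pair n h e A B = vec (n * (2 * h))
     (\<lambda>k. case inv_into (pair_index n h) e k of Inl p \<Rightarrow> A $$ p | Inr p \<Rightarrow> B $$ p)"

text \<open>The blocks of a parameter vector; the lemmas below show that they invert \<^const>\<open>vec_pair\<close>.\<close>

definition block_A ::
  "nat \<Rightarrow> nat \<Rightarrow> (nat \<times> nat + nat \<times> nat \<Rightarrow> nat) \<Rightarrow> real vec \<Rightarrow> real mat" where
  "block_A n h e \<theta> = mat n h (\<lambda>p. \<theta> $ e (Inl p))"

definition block_B ::
  "nat \<Rightarrow> nat \<Rightarrow> (nat \<times> nat + nat \<times> nat \<Rightarrow> nat) \<Rightarrow> real vec \<Rightarrow> real mat" where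
  "block_B n h e \<theta> = mat n h (\<lambda>p. \<theta> $ e (Inr p))"

lemma entry_order_less:
  assumes "entry_order n h e" "q \<in> pair_index n h"
  shows "e q < n * (2 * h)"
  using assms unfolding entry_order_def by (auto dest: bij_betwE)

lemma entry_order_inv:
  assumes "entry_order n h e" "q \<in> pair_index n h"
  shows "inv_into (pair_index n h) e (e q) = q"
  using assms unfolding entry_order_def by (meson bij_betw_inv_into_left)

lemma block_A_vec_pair:
  assumes "entry_order n h e" "A \<in> carrier_mat n h"
  shows "block_A n h e (vec_pair n h e A B) = A"
proof (rule eq_matI)
  fix i j assume "i < dim_row A" "j < dim_col A"
  then have "i < n" "j < h" "Inl (i, j) \<in> pair_index n h"
    using assms by (auto simp: pair_index_def)
  then show "block_A n h e (vec_pair n h e A B) $$ (i, j) = A $$ (i, j)"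
    using entry_order_less[OF assms(1)] entry_order_inv[OF assms(1)]
    by (simp add: block_A_def vec_pair_def)
qed (use assms in \<open>auto simp: block_A_def\<close>)

lemma block_B_vec_pair:
  assumes "entry_order n h e" "B \<in> carrier_mat n h"
  shows "block_B n h e (vec_pair n h e A B) = B"
proof (rule eq_matI)
  fix i j assume "i < dim_row B" "j < dim_col B"
  then have "i < n" "j < h" "Inr (i, j) \<in> pair_index n h"
    using assms by (auto simp: pair_index_def)
  then show "block_B n h e (vec_pair n h e A B) $$ (i, j) = B $$ (i, j)"
    using entry_order_less[OF assms(1)] entry_order_inv[OF assms(1)]
    by (simp add: block_B_def vec_pair_def)
qed (use assms in \<open>auto simp: block_B_def\<close>)

lemma vec_pair_blocks:
  assumes "entry_order n h e" "\<theta> \<in> carrier_vec (n * (2 * h))"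
  shows "vec_pair n h e (block_A n h e \<theta>) (block_B n h e \<theta>) = \<theta>"
proof (rule eq_vecI)
  fix k assume "k < dim_vec \<theta>"
  then have k: "k < n * (2 * h)" using assms by simp
  then obtain q where q: "q \<in> pair_index n h" "e q = k"
    using assms(1) unfolding entry_order_def bij_betw_def by (metis imageE lessThan_iff)
  show "vec_pair n h e (block_A n h e \<theta>) (block_B n h e \<theta>) $ k = \<theta> $ k"
    using q k entry_order_inv[OF assms(1) q(1)]
    by (auto simp: vec_pair_def block_A_def block_B_def pair_index_def)
qed (use assms in \<open>auto simp: vec_pair_def\<close>)

definition skew_X ::
  "nat \<Rightarrow> nat \<Rightarrow> (nat \<times> nat + nat \<times> nat \<Rightarrow> nat) \<Rightarrow> real vec \<Rightarrow> real mat" where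
  "skew_X n h e \<theta> = block_A n h e \<theta> @\<^sub>c (- block_B n h e \<theta>)"

definition skew_Y ::
  "nat \<Rightarrow> nat \<Rightarrow> (nat \<times> nat + nat \<times> nat \<Rightarrow> nat) \<Rightarrow> real vec \<Rightarrow> real mat" where
  "skew_Y n h e \<theta> = block_B n h e \<theta> @\<^sub>c block_A n h e \<theta>"

lemma skew_X_vec_pair:
  assumes "entry_order n h e" "A \<in> carrier_mat n h" "B \<in> carrier_mat n h"
  shows "skew_X n h e (vec_pair n h e A B) = A @\<^sub>c (- B)"
  using assms by (simp add: skew_X_def block_A_vec_pair block_B_vec_pair)

lemma skew_Y_vec_pair:
  assumes "entry_order n h e" "A \<in> carrier_mat n h" "B \<in> carrier_mat n h"
  shows "skew_Y n h e (vec_pair n h e A B) = B @\<^sub>c A"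
  using assms by (simp add: skew_Y_def block_A_vec_pair block_B_vec_pair)

end

theory Submission
  imports Defs "HOL-Analysis.Function_Topology"
begin

text \<open>
  The proof exploits a complex structure. Let \<open>r = 2h\<close> and let \<open>J\<close> be the rotation of
  \<open>\<real>\<^sup>2\<^sup>h\<close> (\<open>cstruct\<close> below) with \<open>J\<^sup>2 = -1\<close>, \<open>J\<^sup>T = -J\<close>. With it \<open>Y(\<theta>) = X(\<theta>) J\<close>, and every
  \<open>n \<times> 2h\<close> matrix is \<open>X(\<theta>)\<close> for some \<open>\<theta>\<close>. So everything can be said in terms of \<open>X\<close> alone: given
  \<open>X\<^sub>0 = X(\<theta>)\<close>, find \<open>X\<close> with \<open>M = X (XJ)\<^sup>T\<close>, with \<open>X\<^sup>T X = (XJ)\<^sup>T XJ\<close>, and with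
  \<open>N = X\<^sub>0\<^sup>T X + (X\<^sub>0 J)\<^sup>T X J\<close> positive semidefinite.

  The equation \<open>M = X (XJ)\<^sup>T\<close> only constrains the symplectic products \<open>x \<bullet> Jy\<close> of the rows of \<open>X\<close>,
  so symplectic maps may be applied to all rows at once. Both remaining conditions turn out to be
  optimality conditions.

  \<^item> Solutions of \<open>M = X (XJ)\<^sup>T\<close> exist with \<open>2h\<close> equal to the rank
    (\<open>skew_symmetric_normal_form\<close>): take a maximal family of hyperbolic pairs for the form
    \<open>x \<bullet> My\<close>. This also shows that the rank is even.
  \<^item> Among all solutions choose those of least Frobenius norm. Comparing with the images under
    symplectic transvections gives \<open>X\<^sup>T X = (XJ)\<^sup>T XJ\<close> (\<open>minimal_norm_imp_balanced\<close>).
  \<^item> Among the solutions of least norm choose one maximizing the Frobenius inner product with \<open>X\<^sub>0\<close>.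
    Comparing with the images under the unitary maps that rotate a single complex line gives that \<open>N\<close>
    is symmetric and positive semidefinite (\<open>maximal_correlation_imp_psd\<close>).

  Both extrema exist by compactness, since a bound on the norm bounds all entries.
\<close>

section \<open>The complex structure\<close>

text \<open>
  The matrix \<open>J = [[0, 1], [-1, 0]]\<close> with blocks of size \<open>h\<close>, as an operator. The form
  \<open>x \<bullet> cstruct h y\<close> is the standard symplectic form on \<open>\<real>\<^sup>2\<^sup>h\<close>.
\<close>

definition cstruct :: "nat \<Rightarrow> real vec \<Rightarrow> real vec" where
  "cstruct h x = vec (2 * h) (\<lambda>k. if k < h then x $ (k + h) else - (x $ (k - h)))"

lemma cstruct_carrier [simp]: "cstruct h x \<in> carrier_vec (2 * h)"
  by (simp add: cstruct_def)

lemma dim_cstruct [simp]: "dim_vec (cstruct h x) = 2 * h"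
  by (simp add: cstruct_def)

lemma sum_halves: "(\<Sum>k\<in>{0..<2 * h}. f k) = (\<Sum>k<h. f k) + (\<Sum>k<h. f (k + h))"
  for f :: "nat \<Rightarrow> real"
proof -
  have "(\<Sum>k\<in>{0..<2 * h}. f k) = (\<Sum>k\<in>{0..<h}. f k) + (\<Sum>k\<in>{h..<2 * h}. f k)"
    by (rule sum.atLeastLessThan_concat[symmetric]) auto
  also have "(\<Sum>k\<in>{h..<2 * h}. f k) = (\<Sum>k\<in>{0..<h}. f (k + h))"
    using sum.shift_bounds_nat_ivl[of f 0 h h] by (simp add: mult_2)
  finally show ?thesis by (simp add: lessThan_atLeast0)
qed

lemma cstruct_add: "x \<in> carrier_vec (2 * h) \<Longrightarrow> y \<in> carrier_vec (2 * h) \<Longrightarrow>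
    cstruct h (x + y) = cstruct h x + cstruct h y"
  by (rule eq_vecI) (auto simp: cstruct_def)

lemma cstruct_smult: "x \<in> carrier_vec (2 * h) \<Longrightarrow> cstruct h (c \<cdot>\<^sub>v x) = c \<cdot>\<^sub>v cstruct h x"
  by (rule eq_vecI) (auto simp: cstruct_def)

lemma cstruct_cstruct: "x \<in> carrier_vec (2 * h) \<Longrightarrow> cstruct h (cstruct h x) = - x"
  by (rule eq_vecI) (auto simp: cstruct_def)

lemma cstruct_scalar_prod:
  assumes "x \<in> carrier_vec (2 * h)" "y \<in> carrier_vec (2 * h)"
  shows "cstruct h x \<bullet> y = - (x \<bullet> cstruct h y)"
proof -
  have "cstruct h x \<bullet> y = (\<Sum>k<h. x $ (k + h) * y $ k) - (\<Sum>k<h. x $ k * y $ (k + h))"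
    using assms by (simp add: scalar_prod_def sum_halves cstruct_def sum_negf)
  moreover have "x \<bullet> cstruct h y = (\<Sum>k<h. x $ k * y $ (k + h)) - (\<Sum>k<h. x $ (k + h) * y $ k)"
    by (simp add: scalar_prod_def sum_halves cstruct_def sum_negf)
  ultimately show ?thesis by simp
qed

lemma cstruct_isometry:
  assumes "x \<in> carrier_vec (2 * h)" "y \<in> carrier_vec (2 * h)"
  shows "cstruct h x \<bullet> cstruct h y = x \<bullet> y"
  using assms by (simp add: cstruct_scalar_prod cstruct_cstruct)

lemma cstruct_orthogonal:
  assumes "x \<in> carrier_vec (2 * h)"
  shows "x \<bullet> cstruct h x = 0"
  using cstruct_scalar_prod[OF assms assms] comm_scalar_prod[OF assms cstruct_carrier[of h x]] by simp

text \<open>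
  The symplectic transvections along \<open>Ju\<close>. The second part records how much the length of a vector
  changes, to first and second order in \<open>t\<close>.
\<close>

lemma transvection:
  fixes u :: "real vec" and t :: real
  assumes u: "u \<in> carrier_vec (2 * h)" and x: "x \<in> carrier_vec (2 * h)"
    and y: "y \<in> carrier_vec (2 * h)"
  defines "g \<equiv> \<lambda>x. x + (t * (x \<bullet> u)) \<cdot>\<^sub>v cstruct h u"
  shows "g x \<bullet> cstruct h (g y) = x \<bullet> cstruct h y"
    and "g x \<bullet> g x = x \<bullet> x + 2 * t * ((x \<bullet> u) * (x \<bullet> cstruct h u)) + t\<^sup>2 * ((x \<bullet> u)\<^sup>2 * (u \<bullet> u))"
proof -
  note scalar_prod_expand =
    scalar_prod_add_distrib[where n = "2 * h"] add_scalar_prod_distrib[where n = "2 * h"]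
    smult_scalar_prod_distrib[where n = "2 * h"] scalar_prod_smult_distrib[where n = "2 * h"]
  have cg: "cstruct h (g y) = cstruct h y + (- (t * (y \<bullet> u))) \<cdot>\<^sub>v u"
    unfolding g_def using u y by (simp add: cstruct_add cstruct_smult cstruct_cstruct, intro eq_vecI) (auto simp: algebra_simps)
  have xu: "u \<bullet> x = x \<bullet> u"
    using u x comm_scalar_prod by metis
  have 1: "cstruct h u \<bullet> cstruct h y = u \<bullet> y" "cstruct h u \<bullet> u = 0" "cstruct h u \<bullet> cstruct h u = u \<bullet> u"
    "cstruct h u \<bullet> x = x \<bullet> cstruct h u" "u \<bullet> y = y \<bullet> u"
    using u x y cstruct_isometry cstruct_orthogonal comm_scalar_prod cstruct_carrier by metis+
  show "g x \<bullet> cstruct h (g y) = x \<bullet> cstruct h y"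
    unfolding cg using u x y by (simp add: g_def scalar_prod_expand 1)
  show "g x \<bullet> g x = x \<bullet> x + 2 * t * ((x \<bullet> u) * (x \<bullet> cstruct h u)) + t\<^sup>2 * ((x \<bullet> u)\<^sup>2 * (u \<bullet> u))"
    using u x y by (simp add: g_def scalar_prod_expand 1 xu) (simp add: power2_eq_square algebra_simps)
qed

text \<open>
  Identify \<open>\<real>\<^sup>2\<^sup>h\<close> with \<open>\<complex>\<^sup>h\<close> by letting \<open>J\<close> be multiplication by the imaginary unit. The map \<open>g\<close>
  multiplies the complex line through \<open>u\<close> by the number \<open>1 + (u \<bullet> u) (p + \<i> q)\<close> and fixes the
  orthogonal complement. The hypothesis on \<open>p\<close> and \<open>q\<close> says that this number has modulus one (when
  \<open>u \<noteq> 0\<close>), so that \<open>g\<close> is unitary: it preserves both the symplectic form and the inner product.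
\<close>

lemma complex_rotation:
  fixes u :: "real vec" and p q :: real
  assumes u: "u \<in> carrier_vec (2 * h)" and x: "x \<in> carrier_vec (2 * h)"
    and y: "y \<in> carrier_vec (2 * h)"
    and pq: "2 * p + (u \<bullet> u) * (p\<^sup>2 + q\<^sup>2) = 0"
  defines "g \<equiv> \<lambda>x. x + (p * (x \<bullet> u) - q * (x \<bullet> cstruct h u)) \<cdot>\<^sub>v u
                      + (q * (x \<bullet> u) + p * (x \<bullet> cstruct h u)) \<cdot>\<^sub>v cstruct h u"
  shows "g x \<bullet> cstruct h (g y) = x \<bullet> cstruct h y" and "g x \<bullet> g y = x \<bullet> y"
proof -
  note scalar_prod_expand =
    scalar_prod_add_distrib[where n = "2 * h"] add_scalar_prod_distrib[where n = "2 * h"]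
    smult_scalar_prod_distrib[where n = "2 * h"] scalar_prod_smult_distrib[where n = "2 * h"]
  have cg: "cstruct h (g y) = cstruct h y + (p * (y \<bullet> u) - q * (y \<bullet> cstruct h u)) \<cdot>\<^sub>v cstruct h u
                      + (- (q * (y \<bullet> u) + p * (y \<bullet> cstruct h u))) \<cdot>\<^sub>v u"
    unfolding g_def using u y by (simp add: cstruct_add cstruct_smult cstruct_cstruct, intro eq_vecI) (auto simp: algebra_simps)
  have 1: "cstruct h u \<bullet> cstruct h y = y \<bullet> u" "cstruct h u \<bullet> u = 0" "u \<bullet> cstruct h u = 0" "cstruct h u \<bullet> cstruct h u = u \<bullet> u"
    "cstruct h u \<bullet> y = y \<bullet> cstruct h u" "u \<bullet> y = y \<bullet> u"
    using u x y cstruct_isometry cstruct_orthogonal comm_scalar_prod cstruct_carrier by metis+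
  have 2: "u \<bullet> cstruct h y = - (y \<bullet> cstruct h u)"
    using cstruct_scalar_prod[OF u y] 1 by simp
  define X where "X = x \<bullet> u"
  define X' where "X' = x \<bullet> cstruct h u"
  define Y where "Y = y \<bullet> u"
  define Y' where "Y' = y \<bullet> cstruct h u"
  have "g x \<bullet> cstruct h (g y) = x \<bullet> cstruct h y + (2 * p + (u \<bullet> u) * (p\<^sup>2 + q\<^sup>2)) * (X' * Y - X * Y')"
    unfolding cg using u x y
    by (simp add: g_def scalar_prod_expand 1 2 X_def[symmetric] X'_def[symmetric] Y_def[symmetric] Y'_def[symmetric])
       (simp add: algebra_simps power2_eq_square)
  then show "g x \<bullet> cstruct h (g y) = x \<bullet> cstruct h y" using pq by simp
  have "g x \<bullet> g y = x \<bullet> y + (2 * p + (u \<bullet> u) * (p\<^sup>2 + q\<^sup>2)) * (X * Y + X' * Y')"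
    using u x y
    by (simp add: g_def scalar_prod_expand 1 2 X_def[symmetric] X'_def[symmetric] Y_def[symmetric] Y'_def[symmetric])
       (simp add: algebra_simps power2_eq_square)
  then show "g x \<bullet> g y = x \<bullet> y" using pq by simp
qed

section \<open>Acting on the rows of a matrix\<close>

definition map_rows :: "('a vec \<Rightarrow> 'a vec) \<Rightarrow> 'a mat \<Rightarrow> 'a mat" where
  "map_rows g X = mat (dim_row X) (dim_col X) (\<lambda>(i, j). g (row X i) $ j)"

lemma map_rows_carrier [simp]: "X \<in> carrier_mat n r \<Longrightarrow> map_rows g X \<in> carrier_mat n r"
  by (simp add: map_rows_def)

lemma row_map_rows:
  assumes "X \<in> carrier_mat n r" "i < n" "g (row X i) \<in> carrier_vec r"
  shows "row (map_rows g X) i = g (row X i)"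
  using assms by (intro eq_vecI) (auto simp: map_rows_def)

text \<open>
  The factor \<open>XJ\<close> that belongs to \<open>X\<close>: the transpose of \<open>J\<close>, which is \<open>-J\<close>, acts on the rows.
\<close>

abbreviation partner :: "nat \<Rightarrow> real mat \<Rightarrow> real mat" where
  "partner h \<equiv> map_rows (\<lambda>x. - cstruct h x)"

lemma mult_transpose_partner:
  assumes X: "X \<in> carrier_mat n (2 * h)" and ij: "i < n" "j < n"
  shows "(X * (partner h X)\<^sup>T) $$ (i, j) = - (row X i \<bullet> cstruct h (row X j))"
proof -
  have "(X * (partner h X)\<^sup>T) $$ (i, j) = row X i \<bullet> row (partner h X) j"
    using X ij by (simp add: map_rows_def)
  also have "row (partner h X) j = - cstruct h (row X j)"
    by (rule row_map_rows[OF X ij(2)]) simp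
  also have "row X i \<bullet> (- cstruct h (row X j)) = - (row X i \<bullet> cstruct h (row X j))"
    using X by simp
  finally show ?thesis .
qed

lemma partner_mult_vec:
  assumes X: "X \<in> carrier_mat n (2 * h)" and u: "u \<in> carrier_vec (2 * h)"
  shows "partner h X *\<^sub>v u = X *\<^sub>v cstruct h u"
proof (rule eq_vecI)
  fix i assume "i < dim_vec (X *\<^sub>v cstruct h u)"
  then have i: "i < n" using X by simp
  have "row (partner h X) i = - cstruct h (row X i)"
    by (rule row_map_rows[OF X i]) simp
  then show "(partner h X *\<^sub>v u) $ i = (X *\<^sub>v cstruct h u) $ i"
    using X u i cstruct_scalar_prod[of "row X i" h u] by (simp add: map_rows_def)
qed (use X in \<open>simp add: map_rows_def\<close>)

section \<open>Hyperbolic pairs and the normal form of a skew-symmetric matrix\<close>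

lemma skew_form:
  fixes M :: "real mat"
  assumes "M \<in> carrier_mat n n" "M\<^sup>T = - M" "x \<in> carrier_vec n" "y \<in> carrier_vec n"
  shows "x \<bullet> (M *\<^sub>v y) = - (y \<bullet> (M *\<^sub>v x))"
proof -
  have "x \<bullet> (M *\<^sub>v y) = (M\<^sup>T *\<^sub>v x) \<bullet> y"
    using assms by (metis transpose_vec_mult_scalar transpose_carrier_mat)
  also have "M\<^sup>T *\<^sub>v x = - (M *\<^sub>v x)"
    using assms by (intro eq_vecI) auto
  also have "(- (M *\<^sub>v x)) \<bullet> y = - (y \<bullet> (M *\<^sub>v x))"
    using assms by (simp add: comm_scalar_prod[of y n "M *\<^sub>v x"])
  finally show ?thesis .
qed

text \<open>
  Pairs \<open>(a\<^sub>k, b\<^sub>k)\<close> that form a symplectic basis of their span for the form \<open>x \<bullet> My\<close>.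
\<close>

definition hyperbolic_family ::
  "nat \<Rightarrow> real mat \<Rightarrow> nat \<Rightarrow> (nat \<Rightarrow> real vec) \<Rightarrow> (nat \<Rightarrow> real vec) \<Rightarrow> bool" where
  "hyperbolic_family n M h a b \<longleftrightarrow>
     (\<forall>k<h. a k \<in> carrier_vec n \<and> b k \<in> carrier_vec n) \<and>
     (\<forall>k<h. \<forall>l<h. a k \<bullet> (M *\<^sub>v a l) = 0 \<and> b k \<bullet> (M *\<^sub>v b l) = 0 \<and>
        a k \<bullet> (M *\<^sub>v b l) = (if k = l then 1 else 0))"

lemma left_inverse_imp_full_column_rank:
  fixes F L :: "'a :: field mat"
  assumes F: "F \<in> carrier_mat n k" and L: "L \<in> carrier_mat k n" and LF: "L * F = 1\<^sub>m k"
  shows "vec_space.rank n F = k" and "k \<le> n"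
proof -
  interpret vec_space "TYPE('a)" n .
  have dist: "distinct (cols F)"
  proof (unfold distinct_conv_nth, intro allI impI)
    fix i j assume "i < length (cols F)" "j < length (cols F)" and ij: "i \<noteq> j"
    then have i: "i < k" "j < k" using F by auto
    show "cols F ! i \<noteq> cols F ! j"
    proof
      assume "cols F ! i = cols F ! j"
      then have "(L * F) $$ (i, i) = (L * F) $$ (i, j)" using F L i by simp
      then show False unfolding LF using i ij by simp
    qed
  qed
  have li: "lin_indpt (set (cols F))"
  proof
    assume "lin_dep (set (cols F))"
    then obtain v where v: "v \<in> carrier_vec k" "v \<noteq> 0\<^sub>v k" "F *\<^sub>v v = 0\<^sub>v n"
      using lin_depE[OF F _ dist] by blast
    have "v = (L * F) *\<^sub>v v" using v by (simp add: LF)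
    also have "\<dots> = L *\<^sub>v (F *\<^sub>v v)" using F L v by simp
    also have "\<dots> = 0\<^sub>v k" unfolding v(3) using L by (intro eq_vecI) auto
    finally show False using v by simp
  qed
  show "rank F = k" by (rule lin_indpt_full_rank[OF F dist li])
  have "card (set (cols F)) \<le> dim"
    by (rule li_le_dim(2)[OF fin_dim _ li]) (use F cols_dim[of F] in auto)
  then show "k \<le> n" using distinct_card[OF dist] F dim_is_n by simp
qed

text \<open>
  The rank depends only on the column space, and each of the two factorizations gives one inclusion
  of column spaces. It is used to transfer the full column rank of the factor \<open>X\<close> to \<open>M\<close>.
\<close>

lemma rank_eq_of_mutual_factors:
  fixes A B :: "'a :: field mat"
  assumes A: "A \<in> carrier_mat n k" and B: "B \<in> carrier_mat n m"
    and C: "C \<in> carrier_mat m k" and D: "D \<in> carrier_mat k m"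
    and AB: "A = B * C" and BA: "B = A * D"
  shows "vec_space.rank n A = vec_space.rank n B"
proof -
  interpret vec_space "TYPE('a)" n .
  have "col_space A \<subseteq> col_space B"
  proof
    fix y assume "y \<in> col_space A"
    then obtain x where x: "x \<in> carrier_vec k" "y = A *\<^sub>v x" "y \<in> carrier_vec n"
      using A by (auto simp: col_space_eq[OF A])
    then have "y = B *\<^sub>v (C *\<^sub>v x)" "C *\<^sub>v x \<in> carrier_vec m" using B C AB by auto
    then show "y \<in> col_space B" using B x by (auto simp: col_space_eq[OF B])
  qed
  moreover have "col_space B \<subseteq> col_space A"
  proof
    fix y assume "y \<in> col_space B"
    then obtain x where x: "x \<in> carrier_vec m" "y = B *\<^sub>v x" "y \<in> carrier_vec n"
      using B by (auto simp: col_space_eq[OF B])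
    then have "y = A *\<^sub>v (D *\<^sub>v x)" "D *\<^sub>v x \<in> carrier_vec k" using A D BA by auto
    then show "y \<in> col_space A" using A x by (auto simp: col_space_eq[OF A])
  qed
  ultimately show ?thesis unfolding rank_def col_space_def by simp
qed

text \<open>
  The columns \<open>Ma\<^sub>k\<close> and \<open>-Mb\<^sub>k\<close>: by \<open>maximal_family_exhausts_form\<close> below, this is the factor
  \<open>[A, -B]\<close> in \<open>M = A B\<^sup>T - B A\<^sup>T\<close> when the family is maximal.
\<close>

definition hyperbolic_factor ::
  "nat \<Rightarrow> real mat \<Rightarrow> nat \<Rightarrow> (nat \<Rightarrow> real vec) \<Rightarrow> (nat \<Rightarrow> real vec) \<Rightarrow> real mat" where
  "hyperbolic_factor n M h a b =
     mat n (2 * h) (\<lambda>(i, k). if k < h then (M *\<^sub>v a k) $ i else - ((M *\<^sub>v b (k - h)) $ i))"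

text \<open>
  Pairing a column of \<open>hyperbolic_factor\<close> with \<open>-b\<^sub>k\<close> or \<open>-a\<^sub>k\<close> reads off a value of the form on the
  family, so these vectors are the rows of a left inverse. Its existence both bounds \<open>h\<close> and shows
  that the factor has rank \<open>2h\<close>.
\<close>

lemma hyperbolic_family_left_inverse:
  assumes M: "M \<in> carrier_mat n n" "M\<^sup>T = - M" and hyp: "hyperbolic_family n M h a b"
  obtains L where "L \<in> carrier_mat (2 * h) n" "L * hyperbolic_factor n M h a b = 1\<^sub>m (2 * h)"
proof
  let ?L = "mat (2 * h) n (\<lambda>(k, i). - (if k < h then b k $ i else a (k - h) $ i))"
  show "?L \<in> carrier_mat (2 * h) n" by simp
  have ab: "a k \<in> carrier_vec n" "b k \<in> carrier_vec n" if "k < h" for k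
    using hyp that by (auto simp: hyperbolic_family_def)
  have row: "row ?L k = (if k < h then - b k else - a (k - h))" if "k < 2 * h" for k
  proof -
    have "k - h < h" if "\<not> k < h" using that \<open>k < 2 * h\<close> by simp
    then show ?thesis using that ab[of k] ab[of "k - h"] by (intro eq_vecI) auto
  qed
  have col: "col (hyperbolic_factor n M h a b) k = (if k < h then M *\<^sub>v a k else - (M *\<^sub>v b (k - h)))" if "k < 2 * h" for k
    using that M by (intro eq_vecI) (auto simp: hyperbolic_factor_def)
  have ba: "b k \<bullet> (M *\<^sub>v a l) = (if k = l then -1 else 0)" if "k < h" "l < h" for k l
    using that hyp skew_form[OF M ab(2)[of k] ab(1)[of l]] by (auto simp: hyperbolic_family_def)
  show "?L * hyperbolic_factor n M h a b = 1\<^sub>m (2 * h)"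
  proof (rule eq_matI)
    fix k l assume "k < dim_row (1\<^sub>m (2 * h))" "l < dim_col (1\<^sub>m (2 * h))"
    then have kl: "k < 2 * h" "l < 2 * h" by auto
    have "(?L * hyperbolic_factor n M h a b) $$ (k, l) = row ?L k \<bullet> col (hyperbolic_factor n M h a b) l"
      using kl by (simp add: hyperbolic_factor_def)
    also have "\<dots> = 1\<^sub>m (2 * h) $$ (k, l)"
      unfolding row[OF kl(1)] col[OF kl(2)]
      using kl M ab[of k] ab[of l] ab[of "k - h"] ab[of "l - h"] hyp ba
      by (auto simp: hyperbolic_family_def)
    finally show "(?L * hyperbolic_factor n M h a b) $$ (k, l) = 1\<^sub>m (2 * h) $$ (k, l)" .
  qed (auto simp: hyperbolic_factor_def)
qed

lemma scalar_prod_projection: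
  fixes a b :: "nat \<Rightarrow> real vec"
  assumes "z \<in> carrier_vec n" "x \<in> carrier_vec n" "\<And>k. k < h \<Longrightarrow> a k \<in> carrier_vec n \<and> b k \<in> carrier_vec n"
  shows "vec n (\<lambda>i. x $ i - (\<Sum>k<h. p k * a k $ i - q k * b k $ i)) \<bullet> z
    = x \<bullet> z - (\<Sum>k<h. p k * (a k \<bullet> z) - q k * (b k \<bullet> z))"
proof -
  have "(\<Sum>i\<in>{0..<n}. (\<Sum>k<h. p k * a k $ i - q k * b k $ i) * z $ i) =
    (\<Sum>k<h. \<Sum>i\<in>{0..<n}. (p k * a k $ i - q k * b k $ i) * z $ i)"
    unfolding sum_distrib_right by (rule sum.swap)
  also have "\<dots> = (\<Sum>k<h. p k * (a k \<bullet> z) - q k * (b k \<bullet> z))"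
    using assms by (intro sum.cong) (auto simp: scalar_prod_def sum_distrib_left sum_subtractf[symmetric] algebra_simps)
  finally show ?thesis using assms
    by (simp add: scalar_prod_def left_diff_distrib sum_subtractf)
qed

text \<open>
  Subtracting from a vector its components along the family gives a projection \<open>\<pi>\<close> whose values are
  orthogonal, for the form, to all \<open>a\<^sub>k\<close> and \<open>b\<^sub>k\<close>. If the form did not vanish on two such values
  \<open>\<pi> x\<close> and \<open>\<pi> y\<close>, then these, after rescaling one of them, would be a further hyperbolic pair.
\<close>

lemma maximal_family_exhausts_form:
  assumes M: "M \<in> carrier_mat n n" "M\<^sup>T = - M" and hyp: "hyperbolic_family n M h a b"
    and maximal: "\<And>a' b'. \<not> hyperbolic_family n M (Suc h) a' b'"
    and x: "x \<in> carrier_vec n" and y: "y \<in> carrier_vec n"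
  shows "x \<bullet> (M *\<^sub>v y) =
    (\<Sum>k<h. (x \<bullet> (M *\<^sub>v b k)) * (a k \<bullet> (M *\<^sub>v y)) - (x \<bullet> (M *\<^sub>v a k)) * (b k \<bullet> (M *\<^sub>v y)))"
proof -
  define \<omega> where "\<omega> u v = u \<bullet> (M *\<^sub>v v)" for u v
  have skew: "\<omega> u v = - \<omega> v u" if "u \<in> carrier_vec n" "v \<in> carrier_vec n" for u v
    unfolding \<omega>_def by (rule skew_form[OF M that])
  define \<pi> where "\<pi> x = vec n (\<lambda>i. x $ i - (\<Sum>k<h. \<omega> x (b k) * a k $ i - \<omega> x (a k) * b k $ i))" for x
  have \<pi>: "\<pi> x \<in> carrier_vec n" for x by (simp add: \<pi>_def)
  have ab: "a k \<in> carrier_vec n" "b k \<in> carrier_vec n" if "k < h" for k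
    using hyp that by (auto simp: hyperbolic_family_def)
  have \<omega>ab: "\<omega> (a k) (a l) = 0" "\<omega> (b k) (b l) = 0" "\<omega> (a k) (b l) = (if k = l then 1 else 0)"
    "\<omega> (b k) (a l) = (if k = l then -1 else 0)"
    if "k < h" "l < h" for k l
    using hyp that skew[OF ab(2)[of k] ab(1)[of l]] by (auto simp: hyperbolic_family_def \<omega>_def)
  have \<omega>\<pi>: "\<omega> (\<pi> x) z = \<omega> x z - (\<Sum>k<h. \<omega> x (b k) * \<omega> (a k) z - \<omega> x (a k) * \<omega> (b k) z)"
    if "x \<in> carrier_vec n" "z \<in> carrier_vec n" for x z
    unfolding \<pi>_def \<omega>_def using that M ab by (intro scalar_prod_projection) auto
  have \<pi>a: "\<omega> (\<pi> x) (a l) = 0" and \<pi>b: "\<omega> (\<pi> x) (b l) = 0"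
    if "x \<in> carrier_vec n" "l < h" for x l
  proof -
    have "(\<Sum>k<h. \<omega> x (b k) * \<omega> (a k) (a l) - \<omega> x (a k) * \<omega> (b k) (a l))
        = (\<Sum>k<h. if k = l then \<omega> x (a l) else 0)"
      using \<open>l < h\<close> \<omega>ab by (intro sum.cong) auto
    then show "\<omega> (\<pi> x) (a l) = 0" using that ab by (simp add: \<omega>\<pi>)
    have "(\<Sum>k<h. \<omega> x (b k) * \<omega> (a k) (b l) - \<omega> x (a k) * \<omega> (b k) (b l))
        = (\<Sum>k<h. if k = l then \<omega> x (b l) else 0)"
      using \<open>l < h\<close> \<omega>ab by (intro sum.cong) auto
    then show "\<omega> (\<pi> x) (b l) = 0" using that ab by (simp add: \<omega>\<pi>)
  qed
  have "\<omega> (\<pi> x) (\<pi> y) = 0"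
  proof (rule ccontr)
    assume nz: "\<omega> (\<pi> x) (\<pi> y) \<noteq> 0"
    define a' where "a' = a(h := \<pi> x)"
    define b' where "b' = b(h := (1 / \<omega> (\<pi> x) (\<pi> y)) \<cdot>\<^sub>v \<pi> y)"
    have self: "\<omega> u u = 0" if "u \<in> carrier_vec n" for u using skew[OF that that] by simp
    have smult: "\<omega> (c \<cdot>\<^sub>v u) v = c * \<omega> u v" "\<omega> u (c \<cdot>\<^sub>v v) = c * \<omega> u v"
      if "u \<in> carrier_vec n" "v \<in> carrier_vec n" for c u v
      using that M by (simp_all add: \<omega>_def mult_mat_vec[where nr = n and nc = n])
    have \<pi>': "\<omega> (a l) (\<pi> x) = 0" "\<omega> (b l) (\<pi> x) = 0"
      if "x \<in> carrier_vec n" "l < h" for x l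
      using \<pi>a[OF that] \<pi>b[OF that] skew[OF ab(1)[OF that(2)] \<pi>] skew[OF ab(2)[OF that(2)] \<pi>] by simp_all
    have "hyperbolic_family n M (Suc h) a' b'"
      unfolding hyperbolic_family_def \<omega>_def[symmetric]
      using nz x y ab \<omega>ab by (auto simp: a'_def b'_def less_Suc_eq \<pi> self smult \<pi>' \<pi>a \<pi>b)
    then show False using maximal by blast
  qed
  \<comment> \<open>By orthogonality to the family, projecting one argument suffices.\<close>
  moreover have "\<omega> (\<pi> x) (\<pi> y) = \<omega> (\<pi> x) y"
  proof -
    have "\<omega> (\<pi> x) (\<pi> y) = - \<omega> (\<pi> y) (\<pi> x)" by (rule skew[OF \<pi> \<pi>])
    also have "\<omega> (\<pi> y) (\<pi> x) = \<omega> y (\<pi> x)"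
    proof -
      have "\<omega> (a k) (\<pi> x) = 0" "\<omega> (b k) (\<pi> x) = 0" if "k < h" for k
        using \<pi>a[OF x that] \<pi>b[OF x that] skew[OF ab(1)[OF that] \<pi>] skew[OF ab(2)[OF that] \<pi>] by simp_all
      then show ?thesis using \<omega>\<pi>[OF y \<pi>] by simp
    qed
    also have "- \<omega> y (\<pi> x) = \<omega> (\<pi> x) y" using skew[OF \<pi> y] by simp
    finally show ?thesis .
  qed
  ultimately show ?thesis using \<omega>\<pi>[OF x y] by (simp add: \<omega>_def)
qed

text \<open>
  The symplectic normal form of a skew-symmetric matrix. Here \<open>X = MC\<close> for the matrix \<open>C\<close> of the
  vectors \<open>a\<^sub>k\<close> and \<open>-b\<^sub>k\<close> of a maximal family, so that \<open>M\<close> and \<open>X\<close> are right multiples of each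
  other and have the same rank.
\<close>

lemma skew_symmetric_normal_form:
  fixes M :: "real mat"
  assumes M: "M \<in> carrier_mat n n" "M\<^sup>T = - M"
  obtains h X where "X \<in> carrier_mat n (2 * h)" "vec_space.rank n M = 2 * h"
    "M = X * (partner h X)\<^sup>T"
proof -
  let ?P = "\<lambda>h. \<exists>a b. hyperbolic_family n M h a b"
  have P0: "?P 0" by (simp add: hyperbolic_family_def)
  have bound: "h \<le> n" if "?P h" for h
  proof -
    obtain a b where hyp: "hyperbolic_family n M h a b" using \<open>?P h\<close> by blast
    obtain L where "L \<in> carrier_mat (2 * h) n" "L * hyperbolic_factor n M h a b = 1\<^sub>m (2 * h)"
      using hyperbolic_family_left_inverse[OF M hyp] .
    from left_inverse_imp_full_column_rank(2)[OF _ this] show ?thesis by (simp add: hyperbolic_factor_def)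
  qed
  define h where "h = Greatest ?P"
  have h: "?P h" unfolding h_def by (rule GreatestI_nat[where P = ?P and b = n, OF P0 bound])
  have max: "k \<le> h" if "?P k" for k unfolding h_def by (rule Greatest_le_nat[where P = ?P and b = n, OF that bound])
  obtain a b where hyp: "hyperbolic_family n M h a b" using h by blast
  have maximal: "\<not> hyperbolic_family n M (Suc h) a' b'" for a' b'
    using max[of "Suc h"] by auto
  have ab: "a k \<in> carrier_vec n" "b k \<in> carrier_vec n" if "k < h" for k
    using hyp that by (auto simp: hyperbolic_family_def)
  define X where "X = hyperbolic_factor n M h a b"
  define C where "C = mat n (2 * h) (\<lambda>(i, k). if k < h then a k $ i else - (b (k - h) $ i))"
  have X: "X \<in> carrier_mat n (2 * h)" by (simp add: X_def hyperbolic_factor_def)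
  have C: "C \<in> carrier_mat n (2 * h)" by (simp add: C_def)
  have form: "M = X * (partner h X)\<^sup>T"
  proof (rule eq_matI)
    fix i j assume "i < dim_row (X * (partner h X)\<^sup>T)"
      "j < dim_col (X * (partner h X)\<^sup>T)"
    then have ij: "i < n" "j < n" using X by (simp_all add: map_rows_def)
    have left: "unit_vec n i \<bullet> (M *\<^sub>v y) = (M *\<^sub>v y) $ i" if "i < n" for i y
      using that M by (intro scalar_prod_left_unit) (auto intro: carrier_vecI)
    have right: "x \<bullet> (M *\<^sub>v unit_vec n j) = - ((M *\<^sub>v x) $ j)" if "x \<in> carrier_vec n" for x
      using skew_form[OF M that, of "unit_vec n j"] left[OF ij(2)] by simp
    have "M $$ (i, j) = (M *\<^sub>v unit_vec n j) $ i" using M ij by simp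
    also have "\<dots> = unit_vec n i \<bullet> (M *\<^sub>v unit_vec n j)" by (simp add: left[OF ij(1)])
    also have "\<dots> = (\<Sum>k<h. (unit_vec n i \<bullet> (M *\<^sub>v b k)) * (a k \<bullet> (M *\<^sub>v unit_vec n j))
        - (unit_vec n i \<bullet> (M *\<^sub>v a k)) * (b k \<bullet> (M *\<^sub>v unit_vec n j)))"
      by (rule maximal_family_exhausts_form[OF M hyp maximal]) simp_all
    also have "\<dots> = (\<Sum>k<h. (M *\<^sub>v a k) $ i * (M *\<^sub>v b k) $ j - (M *\<^sub>v b k) $ i * (M *\<^sub>v a k) $ j)"
      using ab by (intro sum.cong) (auto simp: left[OF ij(1)] right)
    also have "\<dots> = - (row X i \<bullet> cstruct h (row X j))"
      using ij X M by (simp add: scalar_prod_def sum_halves cstruct_def X_def hyperbolic_factor_def sum_negf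
         sum_subtractf)
    also have "\<dots> = (X * (partner h X)\<^sup>T) $$ (i, j)"
      using mult_transpose_partner[OF X ij] by simp
    finally show "M $$ (i, j) = (X * (partner h X)\<^sup>T) $$ (i, j)" .
  qed (use M X in \<open>auto simp: map_rows_def\<close>)
  have XMC: "X = M * C"
  proof (rule eq_matI)
    fix i k assume "i < dim_row (M * C)" "k < dim_col (M * C)"
    then have ik: "i < n" "k < 2 * h" using M C by auto
    have "col C k = (if k < h then a k else - b (k - h))"
    proof -
      have "k - h < h" if "\<not> k < h" using that ik by simp
      then show ?thesis using ik ab[of k] ab[of "k - h"] by (intro eq_vecI) (auto simp: C_def)
    qed
    moreover have "row M i \<bullet> (- b (k - h)) = - (row M i \<bullet> b (k - h))" if "\<not> k < h"
    proof -
      have "dim_vec (b (k - h)) = n" using that ik ab(2)[of "k - h"] by simp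
      then show ?thesis using M ik by simp
    qed
    ultimately show "X $$ (i, k) = (M * C) $$ (i, k)"
      using ik M C by (simp add: X_def hyperbolic_factor_def)
  qed (use M C X in auto)
  obtain L where L: "L \<in> carrier_mat (2 * h) n" "L * X = 1\<^sub>m (2 * h)"
    using hyperbolic_family_left_inverse[OF M hyp] unfolding X_def .
  have "vec_space.rank n M = vec_space.rank n X"
    by (rule rank_eq_of_mutual_factors[OF M(1) X _ C form XMC]) (use X in simp)
  also have "\<dots> = 2 * h" by (rule left_inverse_imp_full_column_rank(1)[OF X L])
  finally show thesis using that X form by blast
qed

section \<open>Extrema over bounded closed sets of matrices\<close>

definition frobenius :: "nat \<Rightarrow> real mat \<Rightarrow> real mat \<Rightarrow> real" where
  "frobenius n A B = (\<Sum>i<n. row A i \<bullet> row B i)"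

lemma entry_le_frobenius:
  assumes "A \<in> carrier_mat n r" "i < n" "j < r"
  shows "(A $$ (i, j))\<^sup>2 \<le> frobenius n A A"
proof -
  have "(A $$ (i, j))\<^sup>2 \<le> (\<Sum>k\<in>{0..<r}. (A $$ (i, k))\<^sup>2)"
    using assms by (intro member_le_sum) auto
  also have "\<dots> = row A i \<bullet> row A i"
    using assms by (auto simp: scalar_prod_def power2_eq_square intro!: sum.cong)
  also have "\<dots> \<le> frobenius n A A"
    unfolding frobenius_def using assms
    by (intro member_le_sum[of i "{..<n}" "\<lambda>i. row A i \<bullet> row A i"]) (auto simp: scalar_prod_def intro!: sum_nonneg)
  finally show ?thesis .
qed

text \<open>
  Tychonoff's theorem for a cube. Below, the entries of a matrix are given by a function on index
  pairs, in the product topology; its values at indices outside the matrix can be arbitrary.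
\<close>

lemma compact_real_box: "compact {x :: 'a \<Rightarrow> real. \<forall>k. x k \<in> {- B..B}}"
proof -
  have "compactin (product_topology (\<lambda>_. euclidean) UNIV) (Pi\<^sub>E (UNIV :: 'a set) (\<lambda>_. {- B..B}))"
    by (simp add: compactin_PiE)
  moreover have "Pi\<^sub>E (UNIV :: 'a set) (\<lambda>_. {- B..B}) = {x. \<forall>k. x k \<in> {- B..B}}"
    by (auto simp: PiE_UNIV_domain)
  ultimately show ?thesis
    by (simp add: euclidean_product_topology)
qed

text \<open>
  Matrices that satisfy \<open>P\<close> have entries bounded by \<open>B + 1\<close>, as \<open>\<surd>B \<le> B + 1\<close>. Extending them by zero
  places them in a cube.
\<close>

lemma bounded_closed_attains_min:
  fixes P :: "real mat \<Rightarrow> bool" and f :: "real mat \<Rightarrow> real"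
  assumes closed: "closed {x. P (mat n r x)}"
    and cont: "continuous_on UNIV (\<lambda>x. f (mat n r x))"
    and X1: "X1 \<in> carrier_mat n r" "P X1"
    and bounded: "\<And>X. X \<in> carrier_mat n r \<Longrightarrow> P X \<Longrightarrow> frobenius n X X \<le> B"
  obtains X where "X \<in> carrier_mat n r" "P X"
    "\<And>Y. Y \<in> carrier_mat n r \<Longrightarrow> P Y \<Longrightarrow> f X \<le> f Y"
proof -
  define entries where "entries = (\<lambda>X (i, j). if i < n \<and> j < r then X $$ (i, j) else (0 :: real))"
  have mat_entries: "mat n r (entries X) = X" if "X \<in> carrier_mat n r" for X
    using that by (intro eq_matI) (auto simp: entries_def)
  define K where "K = {x. P (mat n r x)} \<inter> {x. \<forall>k. x k \<in> {- (B + 1)..B + 1}}"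
  have in_K: "entries X \<in> K" if X: "X \<in> carrier_mat n r" "P X" for X
  proof -
    have B: "0 \<le> B" using bounded[OF X]
      by (rule order_trans[rotated]) (auto simp: frobenius_def scalar_prod_def intro!: sum_nonneg)
    have "\<bar>X $$ (i, j)\<bar> \<le> B + 1" if ij: "i < n" "j < r" for i j
    proof (rule power2_le_imp_le)
      have "\<bar>X $$ (i, j)\<bar>\<^sup>2 \<le> B" using entry_le_frobenius[OF X(1) ij] bounded[OF X] by simp
      also have "\<dots> \<le> (B + 1)\<^sup>2" using B by (simp add: power2_eq_square algebra_simps)
      finally show "\<bar>X $$ (i, j)\<bar>\<^sup>2 \<le> (B + 1)\<^sup>2" .
    qed (use B in simp)
    then have "\<bar>entries X k\<bar> \<le> B + 1" for k
      using B by (cases k) (simp add: entries_def)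
    then have "entries X k \<in> {- (B + 1)..B + 1}" for k
      by (smt (verit) atLeastAtMost_iff)
    then show ?thesis
      using X by (simp add: K_def mat_entries)
  qed
  have "compact K" unfolding K_def
    by (rule closed_Int_compact[OF closed compact_real_box])
  then obtain x where x: "x \<in> K" and min: "\<And>y. y \<in> K \<Longrightarrow> f (mat n r x) \<le> f (mat n r y)"
    using continuous_attains_inf[of K "\<lambda>x. f (mat n r x)"] in_K[OF X1] continuous_on_subset[OF cont]
    by blast
  show thesis
  proof
    show "mat n r x \<in> carrier_mat n r" by simp
    show "P (mat n r x)" using x by (simp add: K_def)
    show "f (mat n r x) \<le> f Y" if "Y \<in> carrier_mat n r" "P Y" for Y
      using min[OF in_K[OF that]] mat_entries that by simp
  qed
qed

section \<open>Solutions that are extremal in norm and correlation\<close>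

text \<open>
  By \<open>mult_transpose_partner\<close>, the equation \<open>X (XJ)\<^sup>T = Y (YJ)\<^sup>T\<close> entry by entry.
\<close>

definition same_form :: "nat \<Rightarrow> nat \<Rightarrow> real mat \<Rightarrow> real mat \<Rightarrow> bool" where
  "same_form n h X Y \<longleftrightarrow> X \<in> carrier_mat n (2 * h) \<and>
     (\<forall>i<n. \<forall>j<n. row X i \<bullet> cstruct h (row X j) = row Y i \<bullet> cstruct h (row Y j))"

lemma continuous_frobenius_left:
  "continuous_on UNIV (\<lambda>x. frobenius n A (mat n r x))"
  and continuous_frobenius_self:
  "continuous_on UNIV (\<lambda>x. frobenius n (mat n r x) (mat n r x))"
  unfolding frobenius_def
   by (auto simp: scalar_prod_def intro!: continuous_intros)

lemma continuous_row_form: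
  assumes "i < n" "j < n"
  shows "continuous_on UNIV (\<lambda>x. row (mat n (2 * h) x) i \<bullet> cstruct h (row (mat n (2 * h) x) j))"
  using assms by (auto simp: scalar_prod_def cstruct_def sum_halves intro!: continuous_intros)

lemma closed_same_form: "closed {x. same_form n h (mat n (2 * h) x) Y}"
proof -
  have "{x. same_form n h (mat n (2 * h) x) Y} =
    (\<Inter>i\<in>{..<n}. \<Inter>j\<in>{..<n}. {x. row (mat n (2 * h) x) i \<bullet> cstruct h (row (mat n (2 * h) x) j)
       = row Y i \<bullet> cstruct h (row Y j)})"
    unfolding same_form_def by auto
  also have "closed \<dots>"
    by (intro closed_INT ballI closed_Collect_eq continuous_row_form continuous_on_const) auto
  finally show ?thesis .
qed

lemma same_form_map_rows:
  assumes "same_form n h X Y"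
    and "\<And>x. x \<in> carrier_vec (2 * h) \<Longrightarrow> g x \<in> carrier_vec (2 * h)"
    and "\<And>x y. x \<in> carrier_vec (2 * h) \<Longrightarrow> y \<in> carrier_vec (2 * h) \<Longrightarrow> g x \<bullet> cstruct h (g y) = x \<bullet> cstruct h y"
  shows "same_form n h (map_rows g X) Y"
proof -
  have X: "X \<in> carrier_mat n (2 * h)" using assms(1) by (simp add: same_form_def)
  then have "row (map_rows g X) i = g (row X i)" if "i < n" for i
    using row_map_rows[OF X that] assms(2) X that by auto
  then show ?thesis using assms X by (auto simp: same_form_def)
qed

lemma mult_mat_vec_scalar_prod:
  fixes A B :: "real mat"
  assumes "A \<in> carrier_mat n r" "B \<in> carrier_mat n s"
  shows "(A *\<^sub>v u) \<bullet> (B *\<^sub>v v) = (\<Sum>i<n. (row A i \<bullet> u) * (row B i \<bullet> v))"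
  using assms by (simp add: scalar_prod_def lessThan_atLeast0)

text \<open>
  The step from optimality to identities, used for both extremal problems: along a curve through an
  optimal point the loss is \<open>b t + a t\<^sup>2\<close> (up to a positive factor).
\<close>

lemma quadratic_nonneg:
  fixes a b :: real
  assumes "\<And>t. 0 \<le> b * t + a * t\<^sup>2"
  shows "b = 0" "0 \<le> a"
proof -
  show a: "0 \<le> a" using assms[of 1] assms[of "-1"] by simp
  show "b = 0"
  proof (rule ccontr)
    assume b: "b \<noteq> 0"
    have "0 \<le> b * (- b / (a + 1)) + a * (- b / (a + 1))\<^sup>2" by (rule assms)
    also have "\<dots> = - (b\<^sup>2 / (a + 1)\<^sup>2)"
      using a by (simp add: divide_simps) (simp add: algebra_simps power2_eq_square)
    finally show False using a b by (simp add: divide_le_0_iff)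
  qed
qed

text \<open>
  Moving all rows by the transvection along \<open>Ju\<close> changes the squared norm of \<open>X\<close> by
  \<open>2t (Xu \<bullet> XJu)\<close> plus a multiple of \<open>t\<^sup>2\<close>. Hence \<open>Xu \<bullet> XJu = 0\<close> for all \<open>u\<close>, and polarization
  turns this into the claim. This is the vanishing of the moment map at a vector of minimal norm in its
  orbit under the symplectic group.
\<close>

lemma minimal_norm_imp_balanced:
  assumes X: "same_form n h X Z"
    and min: "\<And>Y. same_form n h Y Z \<Longrightarrow> frobenius n X X \<le> frobenius n Y Y"
    and u: "u \<in> carrier_vec (2 * h)" and v: "v \<in> carrier_vec (2 * h)"
  shows "(X *\<^sub>v u) \<bullet> (X *\<^sub>v v) = (X *\<^sub>v cstruct h u) \<bullet> (X *\<^sub>v cstruct h v)"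
proof -
  have Xc: "X \<in> carrier_mat n (2 * h)" using X by (simp add: same_form_def)
  have skew: "(X *\<^sub>v u) \<bullet> (X *\<^sub>v cstruct h u) = 0" if u: "u \<in> carrier_vec (2 * h)" for u
  proof -
    have "0 \<le> 2 * ((X *\<^sub>v u) \<bullet> (X *\<^sub>v cstruct h u)) * t
      + ((X *\<^sub>v u) \<bullet> (X *\<^sub>v u) * (u \<bullet> u)) * t\<^sup>2" for t
    proof -
      define g where "g x = x + (t * (x \<bullet> u)) \<cdot>\<^sub>v cstruct h u" for x
      have g: "g x \<in> carrier_vec (2 * h)" if "x \<in> carrier_vec (2 * h)" for x
        using that by (simp add: g_def)
      have "frobenius n X X \<le> frobenius n (map_rows g X) (map_rows g X)"
        by (rule min[OF same_form_map_rows[OF X]])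
          (use g transvection(1)[OF u] in \<open>auto simp: g_def\<close>)
      also have "\<dots> = (\<Sum>i<n. g (row X i) \<bullet> g (row X i))"
        unfolding frobenius_def using Xc g row_map_rows[OF Xc] by (intro sum.cong) auto
      also have "\<dots> = (\<Sum>i<n. row X i \<bullet> row X i + 2 * t * ((row X i \<bullet> u) * (row X i \<bullet> cstruct h u))
          + t\<^sup>2 * ((row X i \<bullet> u)\<^sup>2 * (u \<bullet> u)))"
        unfolding g_def using transvection(2)[OF u _ u] Xc by (intro sum.cong) auto
      also have "\<dots> = frobenius n X X + 2 * ((X *\<^sub>v u) \<bullet> (X *\<^sub>v cstruct h u)) * t
          + ((X *\<^sub>v u) \<bullet> (X *\<^sub>v u) * (u \<bullet> u)) * t\<^sup>2"
        by (simp add: mult_mat_vec_scalar_prod[OF Xc Xc] frobenius_def sum.distrib sum_distrib_left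
            sum_distrib_right power2_eq_square ac_simps)
      finally show ?thesis by simp
    qed
    from quadratic_nonneg(1)[OF this] show ?thesis by simp
  qed
  have Xv: "X *\<^sub>v w \<in> carrier_vec n" for w using Xc by (auto intro: carrier_vecI)
  define w where "w = cstruct h v"
  have w: "w \<in> carrier_vec (2 * h)" "cstruct h w = - v" using v by (simp_all add: w_def cstruct_cstruct)
  \<comment> \<open>Polarize at \<open>u\<close> and \<open>Jv\<close>; as \<open>J (Jv) = -v\<close>, this compares the two sides of the claim.\<close>
  have "(X *\<^sub>v (u + w)) \<bullet> (X *\<^sub>v cstruct h (u + w)) = 0" using skew u w by simp
  then have "(X *\<^sub>v u) \<bullet> (X *\<^sub>v cstruct h w) + (X *\<^sub>v w) \<bullet> (X *\<^sub>v cstruct h u) = 0"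
    using skew[OF u] skew[OF w(1)] u w(1) Xc Xv
    by (simp add: cstruct_add mult_add_distrib_mat_vec[where nr = n and nc = "2 * h"]
       scalar_prod_add_distrib[where n = n] add_scalar_prod_distrib[where n = n])
  moreover have "X *\<^sub>v (- v) = - (X *\<^sub>v v)" using Xc v by (intro eq_vecI) auto
  ultimately show ?thesis using w Xc u v comm_scalar_prod[OF Xv Xv]
    by (simp add: w_def[symmetric])
qed

lemma scalar_prod_self:
  fixes u :: "real vec"
  assumes "u \<in> carrier_vec r"
  shows "0 \<le> u \<bullet> u" and "u \<bullet> u = 0 \<longleftrightarrow> u = 0\<^sub>v r"
proof -
  show "0 \<le> u \<bullet> u" by (auto simp: scalar_prod_def intro: sum_nonneg)
  have "u \<bullet> u = 0 \<longleftrightarrow> (\<forall>i\<in>{0..<r}. u $ i * u $ i = 0)"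
    using assms unfolding scalar_prod_def carrier_vecD[OF assms]
    by (intro sum_nonneg_eq_0_iff) auto
  also have "\<dots> \<longleftrightarrow> u = 0\<^sub>v r" using assms by (auto intro!: eq_vecI)
  finally show "u \<bullet> u = 0 \<longleftrightarrow> u = 0\<^sub>v r" .
qed

text \<open>
  Rotating the complex line through \<open>u\<close> by the unit number \<open>(1 - t\<^sup>2 + 2 \<i> t) / (1 + t\<^sup>2)\<close> keeps the
  norm and the symplectic products of the rows, and changes the inner product with \<open>X\<^sub>0\<close> by a negative multiple of \<open>D u t + N u u t\<^sup>2\<close>, where \<open>D u = X\<^sub>0u \<bullet> XJu - X\<^sub>0Ju \<bullet> Xu\<close>. So \<open>N u u \<ge> 0\<close>
  and \<open>D u = 0\<close> for all \<open>u\<close>; polarizing the latter, with \<open>Jv\<close> in the second place, gives the symmetry.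
\<close>

lemma maximal_correlation_imp_psd:
  assumes X: "same_form n h X Z" and X0: "X0 \<in> carrier_mat n (2 * h)"
    and max: "\<And>Y. same_form n h Y Z \<Longrightarrow> frobenius n Y Y = frobenius n X X
      \<Longrightarrow> frobenius n X0 Y \<le> frobenius n X0 X"
  defines "N \<equiv> \<lambda>u v. (X0 *\<^sub>v u) \<bullet> (X *\<^sub>v v) + (X0 *\<^sub>v cstruct h u) \<bullet> (X *\<^sub>v cstruct h v)"
  assumes u: "u \<in> carrier_vec (2 * h)"
  shows "0 \<le> N u u"
    and "v \<in> carrier_vec (2 * h) \<Longrightarrow> N u v = N v u"
proof -
  have Xc: "X \<in> carrier_mat n (2 * h)" using X by (simp add: same_form_def)
  have Xv: "X *\<^sub>v w \<in> carrier_vec n" "X0 *\<^sub>v w \<in> carrier_vec n" for w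
    using Xc X0 by (auto intro: carrier_vecI)
  define D where "D u = (X0 *\<^sub>v u) \<bullet> (X *\<^sub>v cstruct h u) - (X0 *\<^sub>v cstruct h u) \<bullet> (X *\<^sub>v u)" for u
  have key: "D u = 0 \<and> 0 \<le> N u u" if u: "u \<in> carrier_vec (2 * h)" for u
  proof (cases "u \<bullet> u = 0")
    case True
    then have u0: "u = 0\<^sub>v (2 * h)" using scalar_prod_self[OF u] by simp
    have "cstruct h u = 0\<^sub>v (2 * h)" unfolding u0 by (intro eq_vecI) (auto simp: cstruct_def)
    moreover have "X *\<^sub>v 0\<^sub>v (2 * h) = 0\<^sub>v n" "X0 *\<^sub>v 0\<^sub>v (2 * h) = 0\<^sub>v n"
      using Xc X0 by (auto intro!: eq_vecI)
    ultimately show ?thesis by (simp add: D_def N_def u0)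
  next
    case False
    then have m: "0 < u \<bullet> u" using scalar_prod_self[OF u] by simp
    have "0 \<le> D u * t + N u u * t\<^sup>2" for t
    proof -
      \<comment> \<open>The rational parametrization of the unit circle keeps the first-order term \<open>D u t\<close> and the
        second-order term \<open>N u u t\<^sup>2\<close>, up to the positive factor \<open>\<delta>\<close>, exactly.\<close>
      define \<delta> where "\<delta> = 2 / ((1 + t\<^sup>2) * (u \<bullet> u))"
      have t: "0 < 1 + t\<^sup>2" by (simp add: add_pos_nonneg)
      have \<delta>: "0 < \<delta>" "(u \<bullet> u) * \<delta> * (1 + t\<^sup>2) = 2"
        using m t by (simp_all add: \<delta>_def divide_simps)
      define p where "p = - (t\<^sup>2 * \<delta>)"
      define q where "q = t * \<delta>"
      have "2 * p + (u \<bullet> u) * (p\<^sup>2 + q\<^sup>2) = t\<^sup>2 * \<delta> * ((u \<bullet> u) * \<delta> * (1 + t\<^sup>2) - 2)"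
        by (simp add: p_def q_def power2_eq_square algebra_simps)
      then have pq: "2 * p + (u \<bullet> u) * (p\<^sup>2 + q\<^sup>2) = 0" using \<delta>(2) by simp
      define g where "g x = x + (p * (x \<bullet> u) - q * (x \<bullet> cstruct h u)) \<cdot>\<^sub>v u
                      + (q * (x \<bullet> u) + p * (x \<bullet> cstruct h u)) \<cdot>\<^sub>v cstruct h u" for x
      have g: "g x \<in> carrier_vec (2 * h)" if "x \<in> carrier_vec (2 * h)" for x
        using that u by (simp add: g_def)
      note rot = complex_rotation[OF u _ _ pq, folded g_def]
      have rowg: "row (map_rows g X) i = g (row X i)" if "i < n" for i
        by (rule row_map_rows[OF Xc that]) (use g Xc that in auto)
      have rX: "row X i \<in> carrier_vec (2 * h)" "row X0 i \<in> carrier_vec (2 * h)" if "i < n" for i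
        using Xc X0 that by auto
      have "frobenius n X0 (map_rows g X) \<le> frobenius n X0 X"
      proof (rule max)
        show "same_form n h (map_rows g X) Z" by (rule same_form_map_rows[OF X g rot(1)])
        show "frobenius n (map_rows g X) (map_rows g X) = frobenius n X X"
          unfolding frobenius_def by (intro sum.cong) (auto simp: rowg rot(2) rX)
      qed
      also have "frobenius n X0 (map_rows g X) = (\<Sum>i<n. row X0 i \<bullet> g (row X i))"
        unfolding frobenius_def by (intro sum.cong) (auto simp: rowg)
      also have "\<dots> = (\<Sum>i<n. row X0 i \<bullet> row X i
          + p * ((row X0 i \<bullet> u) * (row X i \<bullet> u) + (row X0 i \<bullet> cstruct h u) * (row X i \<bullet> cstruct h u))
          - q * ((row X0 i \<bullet> u) * (row X i \<bullet> cstruct h u) - (row X0 i \<bullet> cstruct h u) * (row X i \<bullet> u)))"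
      proof (intro sum.cong refl)
        fix i assume "i \<in> {..<n}"
        then have i: "row X i \<in> carrier_vec (2 * h)" "row X0 i \<in> carrier_vec (2 * h)" using rX by auto
        have "row X0 i \<bullet> g (row X i) = row X0 i \<bullet> row X i
           + (p * (row X i \<bullet> u) - q * (row X i \<bullet> cstruct h u)) * (row X0 i \<bullet> u)
           + (q * (row X i \<bullet> u) + p * (row X i \<bullet> cstruct h u)) * (row X0 i \<bullet> cstruct h u)"
          using i u by (simp add: g_def scalar_prod_add_distrib[where n = "2 * h"]
            scalar_prod_smult_distrib[where n = "2 * h"])
        then show "row X0 i \<bullet> g (row X i) = row X0 i \<bullet> row X i
          + p * ((row X0 i \<bullet> u) * (row X i \<bullet> u) + (row X0 i \<bullet> cstruct h u) * (row X i \<bullet> cstruct h u))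
          - q * ((row X0 i \<bullet> u) * (row X i \<bullet> cstruct h u) - (row X0 i \<bullet> cstruct h u) * (row X i \<bullet> u))"
          by (simp add: algebra_simps)
      qed
      also have "\<dots> = frobenius n X0 X + p * N u u - q * D u"
        by (simp add: mult_mat_vec_scalar_prod[OF X0 Xc] frobenius_def sum.distrib sum_subtractf
            sum_distrib_left N_def D_def distrib_left right_diff_distrib)
      finally have "0 \<le> \<delta> * (D u * t + N u u * t\<^sup>2)"
        by (simp add: p_def q_def algebra_simps)
      then show ?thesis using \<delta>(1) by (simp add: zero_le_mult_iff)
    qed
    from quadratic_nonneg[OF this] show ?thesis by simp
  qed
  show "0 \<le> N u u" using key[OF u] by simp
  assume v: "v \<in> carrier_vec (2 * h)"
  define w where "w = cstruct h v"
  have w: "w \<in> carrier_vec (2 * h)" "cstruct h w = - v" using v by (simp_all add: w_def cstruct_cstruct)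
  have "D (u + w) = 0" "D u = 0" "D w = 0" using key u w by auto
  then have "(X0 *\<^sub>v u) \<bullet> (X *\<^sub>v cstruct h w) + (X0 *\<^sub>v w) \<bullet> (X *\<^sub>v cstruct h u)
      - (X0 *\<^sub>v cstruct h u) \<bullet> (X *\<^sub>v w) - (X0 *\<^sub>v cstruct h w) \<bullet> (X *\<^sub>v u) = 0"
    using u w(1) Xc X0 Xv unfolding D_def
    by (simp add: cstruct_add mult_add_distrib_mat_vec[where nr = n and nc = "2 * h"]
       scalar_prod_add_distrib[where n = n] add_scalar_prod_distrib[where n = n])
  moreover have "X *\<^sub>v (- v) = - (X *\<^sub>v v)" "X0 *\<^sub>v (- v) = - (X0 *\<^sub>v v)"
    using Xc X0 v by (auto intro!: eq_vecI)
  ultimately show "N u v = N v u" using w Xc X0 u v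
    by (simp add: w_def[symmetric] N_def)
qed

text \<open>
  The second extremal problem is solved inside the set of solutions of the first: on that set the norm
  is constant, which makes it compact, and unitary maps preserve it.
\<close>

lemma balanced_correlated_representative:
  assumes X1: "X1 \<in> carrier_mat n (2 * h)" and X0: "X0 \<in> carrier_mat n (2 * h)"
  obtains X where "same_form n h X X1"
    "\<And>u v. u \<in> carrier_vec (2 * h) \<Longrightarrow> v \<in> carrier_vec (2 * h) \<Longrightarrow>
      (X *\<^sub>v u) \<bullet> (X *\<^sub>v v) = (X *\<^sub>v cstruct h u) \<bullet> (X *\<^sub>v cstruct h v)"
    "\<And>u. u \<in> carrier_vec (2 * h) \<Longrightarrow>
      0 \<le> (X0 *\<^sub>v u) \<bullet> (X *\<^sub>v u) + (X0 *\<^sub>v cstruct h u) \<bullet> (X *\<^sub>v cstruct h u)"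
    "\<And>u v. u \<in> carrier_vec (2 * h) \<Longrightarrow> v \<in> carrier_vec (2 * h) \<Longrightarrow>
      (X0 *\<^sub>v u) \<bullet> (X *\<^sub>v v) + (X0 *\<^sub>v cstruct h u) \<bullet> (X *\<^sub>v cstruct h v)
      = (X0 *\<^sub>v v) \<bullet> (X *\<^sub>v u) + (X0 *\<^sub>v cstruct h v) \<bullet> (X *\<^sub>v cstruct h u)"
proof -
  have "same_form n h X1 X1" using X1 by (simp add: same_form_def)
  then obtain X2 where X2: "same_form n h X2 X1"
    and min: "\<And>Y. same_form n h Y X1 \<Longrightarrow> frobenius n X2 X2 \<le> frobenius n Y Y"
  proof -
    let ?P = "\<lambda>X. same_form n h X X1 \<and> frobenius n X X \<le> frobenius n X1 X1"
    have "closed {x. ?P (mat n (2 * h) x)}"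
      by (intro closed_Collect_conj closed_same_form closed_Collect_le continuous_frobenius_self
          continuous_on_const)
    then obtain X where X: "?P X"
      and min: "\<And>Y. Y \<in> carrier_mat n (2 * h) \<Longrightarrow> ?P Y \<Longrightarrow> frobenius n X X \<le> frobenius n Y Y"
      using bounded_closed_attains_min[of ?P n "2 * h" "\<lambda>X. frobenius n X X" X1 "frobenius n X1 X1",
          OF _ continuous_frobenius_self X1]
        \<open>same_form n h X1 X1\<close> by blast
    show thesis
    proof (rule that)
      \<comment> \<open>Solutions of norm larger than that of \<open>X1\<close> were excluded only to get a bounded set.\<close>
      show "same_form n h X X1" using X by simp
      show "frobenius n X X \<le> frobenius n Y Y" if "same_form n h Y X1" for Y
        using min[of Y] that X by (cases "frobenius n Y Y \<le> frobenius n X1 X1") (auto simp: same_form_def)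
    qed
  qed
  obtain X where X: "same_form n h X X1" "frobenius n X X = frobenius n X2 X2"
    and max: "\<And>Y. same_form n h Y X1 \<Longrightarrow> frobenius n Y Y = frobenius n X2 X2
      \<Longrightarrow> frobenius n X0 Y \<le> frobenius n X0 X"
  proof -
    let ?P = "\<lambda>X. same_form n h X X1 \<and> frobenius n X X = frobenius n X2 X2"
    have closed: "closed {x. ?P (mat n (2 * h) x)}"
      by (intro closed_Collect_conj closed_same_form closed_Collect_eq continuous_frobenius_self
          continuous_on_const)
    have cont: "continuous_on UNIV (\<lambda>x. - frobenius n X0 (mat n (2 * h) x))"
      by (intro continuous_on_minus continuous_frobenius_left)
    have "X2 \<in> carrier_mat n (2 * h)" using X2 by (simp add: same_form_def)
    then obtain X where X: "?P X"
      and min: "\<And>Y. Y \<in> carrier_mat n (2 * h) \<Longrightarrow> ?P Y \<Longrightarrow> - frobenius n X0 X \<le> - frobenius n X0 Y"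
      using bounded_closed_attains_min[of ?P n "2 * h" "\<lambda>X. - frobenius n X0 X" X2 "frobenius n X2 X2",
          OF closed cont] X2 by auto
    show thesis
      by (rule that[of X]) (use X min in \<open>auto simp: same_form_def\<close>)
  qed
  show thesis
  proof (rule that[OF X(1)])
    show "(X *\<^sub>v u) \<bullet> (X *\<^sub>v v) = (X *\<^sub>v cstruct h u) \<bullet> (X *\<^sub>v cstruct h v)"
      if "u \<in> carrier_vec (2 * h)" "v \<in> carrier_vec (2 * h)" for u v
      by (rule minimal_norm_imp_balanced[OF X(1) _ that]) (use min X(2) in simp)
  qed (use maximal_correlation_imp_psd[OF X(1) X0] max X(2) in auto)
qed

lemma scalar_prod_transpose_mult:
  fixes A B :: "real mat"
  assumes A: "A \<in> carrier_mat n k" and B: "B \<in> carrier_mat n m"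
    and u: "u \<in> carrier_vec k" and v: "v \<in> carrier_vec m"
  shows "u \<bullet> ((A\<^sup>T * B) *\<^sub>v v) = (A *\<^sub>v u) \<bullet> (B *\<^sub>v v)"
proof -
  have "u \<bullet> ((A\<^sup>T * B) *\<^sub>v v) = u \<bullet> (A\<^sup>T *\<^sub>v (B *\<^sub>v v))"
    using A B v by (simp add: assoc_mult_mat_vec[where ?n\<^sub>1.0 = k and ?n\<^sub>2.0 = n and ?n\<^sub>3.0 = m])
  also have "\<dots> = (A\<^sup>T\<^sup>T *\<^sub>v u) \<bullet> (B *\<^sub>v v)"
    using A B u by (intro transpose_vec_mult_scalar[symmetric]) (auto intro: carrier_vecI)
  finally show ?thesis by simp
qed

lemma mat_eq_of_scalar_prods:
  fixes A B :: "real mat"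
  assumes A: "A \<in> carrier_mat n m" and B: "B \<in> carrier_mat n m"
    and eq: "\<And>u v. u \<in> carrier_vec n \<Longrightarrow> v \<in> carrier_vec m \<Longrightarrow> u \<bullet> (A *\<^sub>v v) = u \<bullet> (B *\<^sub>v v)"
  shows "A = B"
proof (rule eq_matI)
  fix i j assume "i < dim_row B" "j < dim_col B"
  then have ij: "i < n" "j < m" using B by auto
  have "unit_vec n i \<bullet> (C *\<^sub>v unit_vec m j) = C $$ (i, j)" if "C \<in> carrier_mat n m" for C :: "real mat"
  proof -
    have "unit_vec n i \<bullet> (C *\<^sub>v unit_vec m j) = (C *\<^sub>v unit_vec m j) $ i"
      using that ij by (intro scalar_prod_left_unit) (auto intro: carrier_vecI)
    then show ?thesis using that ij by simp
  qed
  then show "A $$ (i, j) = B $$ (i, j)" using eq[of "unit_vec n i" "unit_vec m j"] A B by simp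
qed (use A B in auto)

lemma correlated_representative:
  assumes X1: "X1 \<in> carrier_mat n (2 * h)" and X0: "X0 \<in> carrier_mat n (2 * h)"
  defines "J \<equiv> partner h"
  obtains X where "X \<in> carrier_mat n (2 * h)" "X * (J X)\<^sup>T = X1 * (J X1)\<^sup>T"
    "X\<^sup>T * X = (J X)\<^sup>T * J X" "pos_semidef (X0\<^sup>T * X + (J X0)\<^sup>T * J X)"
proof -
  obtain X where form: "same_form n h X X1"
    and bal: "\<And>u v. u \<in> carrier_vec (2 * h) \<Longrightarrow> v \<in> carrier_vec (2 * h) \<Longrightarrow>
      (X *\<^sub>v u) \<bullet> (X *\<^sub>v v) = (X *\<^sub>v cstruct h u) \<bullet> (X *\<^sub>v cstruct h v)"
    and nonneg: "\<And>u. u \<in> carrier_vec (2 * h) \<Longrightarrow>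
      0 \<le> (X0 *\<^sub>v u) \<bullet> (X *\<^sub>v u) + (X0 *\<^sub>v cstruct h u) \<bullet> (X *\<^sub>v cstruct h u)"
    and sym: "\<And>u v. u \<in> carrier_vec (2 * h) \<Longrightarrow> v \<in> carrier_vec (2 * h) \<Longrightarrow>
      (X0 *\<^sub>v u) \<bullet> (X *\<^sub>v v) + (X0 *\<^sub>v cstruct h u) \<bullet> (X *\<^sub>v cstruct h v)
      = (X0 *\<^sub>v v) \<bullet> (X *\<^sub>v u) + (X0 *\<^sub>v cstruct h v) \<bullet> (X *\<^sub>v cstruct h u)"
    by (rule balanced_correlated_representative[OF X1 X0]) blast
  have X: "X \<in> carrier_mat n (2 * h)" using form by (simp add: same_form_def)
  have J: "J Z \<in> carrier_mat n (2 * h)" if "Z \<in> carrier_mat n (2 * h)" for Z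
    using that by (simp add: J_def)
  have Jv: "J Z *\<^sub>v u = Z *\<^sub>v cstruct h u" if "Z \<in> carrier_mat n (2 * h)" "u \<in> carrier_vec (2 * h)" for Z u
    unfolding J_def by (rule partner_mult_vec[OF that])
  let ?N = "X0\<^sup>T * X + (J X0)\<^sup>T * J X"
  have N: "?N \<in> carrier_mat (2 * h) (2 * h)" using J[OF X] J[OF X0] X X0 by simp
  have Nv: "u \<bullet> (?N *\<^sub>v v) = (X0 *\<^sub>v u) \<bullet> (X *\<^sub>v v) + (X0 *\<^sub>v cstruct h u) \<bullet> (X *\<^sub>v cstruct h v)"
    if "u \<in> carrier_vec (2 * h)" "v \<in> carrier_vec (2 * h)" for u v
  proof -
    have "?N *\<^sub>v v = (X0\<^sup>T * X) *\<^sub>v v + ((J X0)\<^sup>T * J X) *\<^sub>v v"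
      using that J[OF X] J[OF X0] X X0 by (intro add_mult_distrib_mat_vec[of _ "2 * h" "2 * h"]) auto
    moreover have "u \<bullet> ((X0\<^sup>T * X) *\<^sub>v v + ((J X0)\<^sup>T * J X) *\<^sub>v v) =
        u \<bullet> ((X0\<^sup>T * X) *\<^sub>v v) + u \<bullet> (((J X0)\<^sup>T * J X) *\<^sub>v v)"
      using that J[OF X] J[OF X0] X X0
      by (intro scalar_prod_add_distrib[of _ "2 * h"]) (auto intro!: mult_mat_vec_carrier[of _ _ "2 * h"])
    ultimately show ?thesis
      using that by (simp add: scalar_prod_transpose_mult[OF X0 X] Jv X X0
          scalar_prod_transpose_mult[OF J[OF X0] J[OF X]])
  qed
  show thesis
  proof (rule that[OF X])
    show "X * (J X)\<^sup>T = X1 * (J X1)\<^sup>T"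
    proof (rule eq_matI)
      fix i j assume "i < dim_row (X1 * (J X1)\<^sup>T)" "j < dim_col (X1 * (J X1)\<^sup>T)"
      then have ij: "i < n" "j < n" using X1 J[OF X1] by auto
      then show "(X * (J X)\<^sup>T) $$ (i, j) = (X1 * (J X1)\<^sup>T) $$ (i, j)"
        using form unfolding J_def
        by (simp only: mult_transpose_partner[OF X ij] mult_transpose_partner[OF X1 ij] same_form_def)
    qed (use X X1 J[OF X] J[OF X1] in auto)
    show "X\<^sup>T * X = (J X)\<^sup>T * J X"
    proof (rule mat_eq_of_scalar_prods)
      show "u \<bullet> ((X\<^sup>T * X) *\<^sub>v v) = u \<bullet> (((J X)\<^sup>T * J X) *\<^sub>v v)"
        if "u \<in> carrier_vec (2 * h)" "v \<in> carrier_vec (2 * h)" for u v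
        using that bal[OF that] by (simp add: scalar_prod_transpose_mult[OF X X] Jv X
            scalar_prod_transpose_mult[OF J[OF X] J[OF X]])
    qed (use X J[OF X] in auto)
    have "?N\<^sup>T = ?N"
    proof (rule mat_eq_of_scalar_prods)
      show "u \<bullet> (?N\<^sup>T *\<^sub>v v) = u \<bullet> (?N *\<^sub>v v)"
        if u: "u \<in> carrier_vec (2 * h)" and v: "v \<in> carrier_vec (2 * h)" for u v
      proof -
        have "u \<bullet> (?N\<^sup>T *\<^sub>v v) = (?N\<^sup>T *\<^sub>v v) \<bullet> u"
          using u v N by (intro comm_scalar_prod) (auto intro!: mult_mat_vec_carrier[of _ _ "2 * h"])
        also have "\<dots> = v \<bullet> (?N *\<^sub>v u)" by (rule transpose_vec_mult_scalar[OF N u v])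
        also have "\<dots> = u \<bullet> (?N *\<^sub>v v)" using sym[OF u v] by (simp only: Nv[OF u v] Nv[OF v u])
        finally show ?thesis .
      qed
    qed (use N in auto)
    then show "pos_semidef ?N"
      unfolding pos_semidef_def square_mat.simps carrier_matD[OF N] using nonneg Nv by simp
  qed
qed

section \<open>The parametrization\<close>

lemma skew_X_carrier: "skew_X n h e \<theta> \<in> carrier_mat n (2 * h)"
  by (auto simp: skew_X_def append_cols_def block_A_def block_B_def)

lemma skew_Y_carrier: "skew_Y n h e \<theta> \<in> carrier_mat n (2 * h)"
  by (auto simp: skew_Y_def append_cols_def block_A_def block_B_def)

lemma skew_X_index:
  "i < n \<Longrightarrow> k < 2 * h \<Longrightarrow>
    skew_X n h e \<theta> $$ (i, k) = (if k < h then \<theta> $ e (Inl (i, k)) else - (\<theta> $ e (Inr (i, k - h))))"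
  by (auto simp: skew_X_def append_cols_def block_A_def block_B_def)

lemma skew_Y_eq_partner: "skew_Y n h e \<theta> = partner h (skew_X n h e \<theta>)"
proof (rule eq_matI)
  fix i k assume "i < dim_row (partner h (skew_X n h e \<theta>))"
    "k < dim_col (partner h (skew_X n h e \<theta>))"
  then have "i < n" "k < 2 * h" using skew_X_carrier[of n h e \<theta>] by (auto simp: map_rows_def)
  then show "skew_Y n h e \<theta> $$ (i, k) = partner h (skew_X n h e \<theta>) $$ (i, k)"
    using skew_X_carrier[of n h e \<theta>]
    by (auto simp: map_rows_def cstruct_def skew_X_index)
       (auto simp: skew_Y_def append_cols_def block_A_def block_B_def)
qed (use skew_X_carrier[of n h e \<theta>] skew_Y_carrier[of n h e \<theta>] in \<open>auto simp: map_rows_def\<close>)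

lemma skew_X_surj:
  assumes e: "entry_order n h e" and X: "X \<in> carrier_mat n (2 * h)"
  obtains \<xi> where "\<xi> \<in> carrier_vec (n * (2 * h))" "skew_X n h e \<xi> = X"
proof
  let ?A = "mat n h (\<lambda>(i, j). X $$ (i, j))" and ?B = "mat n h (\<lambda>(i, j). - X $$ (i, j + h))"
  show "vec_pair n h e ?A ?B \<in> carrier_vec (n * (2 * h))" by (simp add: vec_pair_def)
  have "skew_X n h e (vec_pair n h e ?A ?B) = ?A @\<^sub>c (- ?B)"
    by (rule skew_X_vec_pair[OF e]) auto
  also have "\<dots> = X" using X by (intro eq_matI) (auto simp: append_cols_def)
  finally show "skew_X n h e (vec_pair n h e ?A ?B) = X" .
qed

lemma linear_map_matI:
  assumes carrier: "\<And>\<theta>. f \<theta> \<in> carrier_mat n m"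
    and add: "\<And>\<theta> \<eta>. \<theta> \<in> carrier_vec d \<Longrightarrow> \<eta> \<in> carrier_vec d \<Longrightarrow> f (\<theta> + \<eta>) = f \<theta> + f \<eta>"
    and smult: "\<And>c \<theta>. \<theta> \<in> carrier_vec d \<Longrightarrow> f (c \<cdot>\<^sub>v \<theta>) = c \<cdot>\<^sub>m f \<theta>"
  shows "linear_map class_ring (module_vec TYPE(real) d) (module_mat TYPE(real) n m) f"
proof -
  have V: "vectorspace class_ring (module_vec TYPE(real) d)" by (rule vec_vs)
  have W: "vectorspace class_ring (module_mat TYPE(real) n m)" by (rule matrix_vs)
  show ?thesis
    using V W carrier add smult
    by (auto simp: linear_map_def mod_hom_def mod_hom_axioms_def vectorspace_def module_vec_simps
        module_mat_simps LinearCombinations.module_hom_def)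
qed

lemma linear_skew_X:
  assumes e: "entry_order n h e"
  shows "linear_map class_ring (module_vec TYPE(real) (n * (2 * h))) (module_mat TYPE(real) n (2 * h))
    (skew_X n h e)"
proof (rule linear_map_matI)
  have "Inl (i, k) \<in> pair_index n h" "Inr (i, k) \<in> pair_index n h" if "i < n" "k < h" for i k
    using that by (auto simp: pair_index_def)
  note less = this[THEN entry_order_less[OF e]]
  have half: "k - h < h" if "k < 2 * h" "\<not> k < h" for k using that by simp
  show "skew_X n h e (\<theta> + \<eta>) = skew_X n h e \<theta> + skew_X n h e \<eta>"
    if "\<theta> \<in> carrier_vec (n * (2 * h))" "\<eta> \<in> carrier_vec (n * (2 * h))" for \<theta> \<eta>
    using that skew_X_carrier[of n h e] less half
    by (intro eq_matI) (auto simp: skew_X_index carrier_matD[OF skew_X_carrier])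
  show "skew_X n h e (c \<cdot>\<^sub>v \<theta>) = c \<cdot>\<^sub>m skew_X n h e \<theta>"
    if "\<theta> \<in> carrier_vec (n * (2 * h))" for \<theta> c
    using that skew_X_carrier[of n h e] less half
    by (intro eq_matI) (auto simp: skew_X_index carrier_matD[OF skew_X_carrier])
qed (rule skew_X_carrier)

lemma linear_skew_Y:
  assumes e: "entry_order n h e"
  shows "linear_map class_ring (module_vec TYPE(real) (n * (2 * h))) (module_mat TYPE(real) n (2 * h))
    (skew_Y n h e)"
proof (rule linear_map_matI)
  note X = linear_skew_X[OF e]
  have rowX: "row (skew_X n h e \<theta>) i \<in> carrier_vec (2 * h)" if "i < n" for \<theta> i
    using skew_X_carrier[of n h e \<theta>] that by simp
  have add: "skew_X n h e (\<theta> + \<eta>) = skew_X n h e \<theta> + skew_X n h e \<eta>"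
    if "\<theta> \<in> carrier_vec (n * (2 * h))" "\<eta> \<in> carrier_vec (n * (2 * h))" for \<theta> \<eta>
    using linear_map.T_add[OF X] that by (simp add: module_vec_simps module_mat_simps)
  have smult: "skew_X n h e (c \<cdot>\<^sub>v \<theta>) = c \<cdot>\<^sub>m skew_X n h e \<theta>"
    if "\<theta> \<in> carrier_vec (n * (2 * h))" for \<theta> c
    using linear_map.T_smult[OF X] that by (simp add: module_vec_simps module_mat_simps)
  show "skew_Y n h e (\<theta> + \<eta>) = skew_Y n h e \<theta> + skew_Y n h e \<eta>"
    if "\<theta> \<in> carrier_vec (n * (2 * h))" "\<eta> \<in> carrier_vec (n * (2 * h))" for \<theta> \<eta>
    unfolding skew_Y_eq_partner add[OF that]
    by (intro eq_matI) (auto simp: map_rows_def carrier_matD[OF skew_X_carrier] cstruct_add rowX cstruct_def)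
  show "skew_Y n h e (c \<cdot>\<^sub>v \<theta>) = c \<cdot>\<^sub>m skew_Y n h e \<theta>"
    if "\<theta> \<in> carrier_vec (n * (2 * h))" for \<theta> c
    unfolding skew_Y_eq_partner smult[OF that]
    by (intro eq_matI) (auto simp: map_rows_def carrier_matD[OF skew_X_carrier] cstruct_smult rowX cstruct_def)
qed (rule skew_Y_carrier)

theorem lemma2p4:
  fixes M :: "real mat" and n r :: nat
  assumes "M \<in> carrier_mat n n"
    and "M\<^sup>T = - M"
    and "vec_space.rank n M = r"
  shows "even r \<and>
    (\<forall>e. entry_order n (r div 2) e \<longrightarrow>
       correlated_parametric_factorization n n r (n * r) M
         (skew_X n (r div 2) e) (skew_Y n (r div 2) e))"
proof -
  obtain h X1 where X1: "X1 \<in> carrier_mat n (2 * h)" and rank: "vec_space.rank n M = 2 * h"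
    and M: "M = X1 * (partner h X1)\<^sup>T"
    by (rule skew_symmetric_normal_form[OF assms(1,2)])
  have r: "r = 2 * h" using rank assms(3) by simp
  have "correlated_parametric_factorization n n (2 * h) (n * (2 * h)) M (skew_X n h e) (skew_Y n h e)"
    if e: "entry_order n h e" for e
    unfolding correlated_parametric_factorization_def
  proof (intro conjI ballI)
    fix \<theta> :: "real vec"
    obtain X where X: "X \<in> carrier_mat n (2 * h)"
      "X * (partner h X)\<^sup>T = M"
      "X\<^sup>T * X = (partner h X)\<^sup>T * partner h X"
      "pos_semidef ((skew_X n h e \<theta>)\<^sup>T * X
         + (partner h (skew_X n h e \<theta>))\<^sup>T * partner h X)"
      using correlated_representative[OF X1 skew_X_carrier[of n h e \<theta>]] unfolding M by blast
    obtain \<xi> where "\<xi> \<in> carrier_vec (n * (2 * h))" "skew_X n h e \<xi> = X"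
      by (rule skew_X_surj[OF e X(1)])
    then show "\<exists>\<xi>\<in>carrier_vec (n * (2 * h)).
        M = skew_X n h e \<xi> * (skew_Y n h e \<xi>)\<^sup>T \<and>
        (skew_X n h e \<xi>)\<^sup>T * skew_X n h e \<xi> = (skew_Y n h e \<xi>)\<^sup>T * skew_Y n h e \<xi> \<and>
        pos_semidef ((skew_X n h e \<theta>)\<^sup>T * skew_X n h e \<xi> + (skew_Y n h e \<theta>)\<^sup>T * skew_Y n h e \<xi>)"
      using X unfolding skew_Y_eq_partner by (intro bexI[of _ \<xi>]) simp_all
  qed (use assms(1) rank linear_skew_X[OF e] linear_skew_Y[OF e] in auto)
  then show ?thesis by (simp add: r)
qed

end
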